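(* Let $N\ge 2$ and $K\ge 1$ be integers, let $\alpha_k,\beta_k,\delta_k>0$ for $k=1,\dots,K$, and let $x(t)$ be the inhomogeneous symmetric simple exclusion process with open boundaries on $G=\{0,1,\dots,K\}^N$ with these rates. Then the type $k$ particle arrival rate $J_k$ in the stationary mode is $$J_k=\frac{2\alpha_k}{1+\sum_{l=1}^K\frac{\alpha_l}{\beta_l}},\quad k=1,\dots,K.$$
   Context: The process: $x(t)=(x_1(t),\dots,x_N(t))$, $t\ge0$, is a continuous-time Markov chain with finite state space $G=\{0,1,\dots,K\}^N$. Sites are numbered $1,\dots,N$ from left to right; $x_i=0$ means that site $i$ is vacant, and $x_i=k\in\{1,\dots,K\}$ means that site $i$ is occupied by a particle of type $k$. The transitions and their rates are, for each $k=1,\dots,K$: (arrival) for $i=1$ and for $i=N$, if $x_i=0$, then $x_i$ changes to $k$ at rate $\alpha_k$ (a particle of type $k$ enters from outside); (departure) for $i=1$ and for $i=N$, if $x_i=k$, then $x_i$ changes to $0$ at rate $\beta_k$ (the particle leaves the system); (hop) for any two adjacent sites $i,j\in\{1,\dots,N\}$, $|i-j|=1$, if $x_i=k$ and $x_j=0$, then the particle in site $i$ moves to site $j$ (so $x_i$ becomes $0$ and $x_j$ becomes $k$) at rate $\delta_k$. No other transitions occur. Arrival rate: $J_k$ is the average (expected) number of particles of type $k$ that enter the system from outside (at site $1$ or at site $N$) per unit of time, when the process is in the stationary mode (i.e. started from its stationary distribution). *)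

theory Defs
  imports "HOL-Probability.Probability"
begin

section \<open>Continuous-time Markov chains on a finite state space\<close>

text \<open>A chain on a finite set \<open>S\<close> is given by its jump rates: \<open>q x y\<close> is the rate of the
  transition from \<open>x\<close> to \<open>y\<close>, for \<open>x \<noteq> y\<close>.  The values \<open>q x x\<close> are irrelevant.\<close>

definition generator :: "'s set \<Rightarrow> ('s \<Rightarrow> 's \<Rightarrow> real) \<Rightarrow> 's \<Rightarrow> 's \<Rightarrow> real" where
  "generator S q x y = (if x = y then - (\<Sum>z\<in>S - {x}. q x z) else q x y)"

primrec generator_power :: "'s set \<Rightarrow> ('s \<Rightarrow> 's \<Rightarrow> real) \<Rightarrow> nat \<Rightarrow> 's \<Rightarrow> 's \<Rightarrow> real" where
  "generator_power S q 0 x y = (if x = y then 1 else 0)"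
| "generator_power S q (Suc n) x y = (\<Sum>z\<in>S. generator S q x z * generator_power S q n z y)"

text \<open>The transition function is the matrix exponential \<open>exp (t Q)\<close> of the generator \<open>Q\<close>.\<close>

definition transition_function :: "'s set \<Rightarrow> ('s \<Rightarrow> 's \<Rightarrow> real) \<Rightarrow> real \<Rightarrow> 's \<Rightarrow> 's \<Rightarrow> real" where
  "transition_function S q t x y = (\<Sum>n. t ^ n / fact n * generator_power S q n x y)"

definition stationary_distribution :: "'s set \<Rightarrow> ('s \<Rightarrow> 's \<Rightarrow> real) \<Rightarrow> ('s \<Rightarrow> real) \<Rightarrow> bool" where
  "stationary_distribution S q \<pi> \<longleftrightarrow>
     (\<forall>x\<in>S. 0 \<le> \<pi> x) \<and> (\<Sum>x\<in>S. \<pi> x) = 1 \<and>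
     (\<forall>t\<ge>0. \<forall>y\<in>S. (\<Sum>x\<in>S. \<pi> x * transition_function S q t x y) = \<pi> y)"

text \<open>The Markov property is stated in product form, so that no conditioning on null events
  occurs.  The last two conditions say that the paths are right-continuous with left limits with
  respect to the discrete topology on \<open>S\<close>.\<close>

definition markov_chain ::
  "'s set \<Rightarrow> ('s \<Rightarrow> 's \<Rightarrow> real) \<Rightarrow> 'w measure \<Rightarrow> (real \<Rightarrow> 'w \<Rightarrow> 's) \<Rightarrow> bool" where
  "markov_chain S q M X \<longleftrightarrow>
     prob_space M \<and>
     (\<forall>t\<ge>0. X t \<in> measurable M (count_space S)) \<and>
     (\<forall>n ts xs. 0 \<le> ts 0 \<longrightarrow> (\<forall>i\<le>n. ts i \<le> ts (Suc i)) \<longrightarrow> (\<forall>i\<le>Suc n. xs i \<in> S) \<longrightarrow>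
        measure M {\<omega> \<in> space M. \<forall>i\<le>Suc n. X (ts i) \<omega> = xs i} =
        measure M {\<omega> \<in> space M. \<forall>i\<le>n. X (ts i) \<omega> = xs i} *
          transition_function S q (ts (Suc n) - ts n) (xs n) (xs (Suc n))) \<and>
     (\<forall>\<omega>\<in>space M. \<forall>t\<ge>0. \<forall>\<^sub>F u in at_right t. X u \<omega> = X t \<omega>) \<and>
     (\<forall>\<omega>\<in>space M. \<forall>t>0. \<exists>y\<in>S. \<forall>\<^sub>F u in at_left t. X u \<omega> = y)"


section \<open>The exclusion process with open boundaries\<close>

definition sep_states :: "nat \<Rightarrow> nat \<Rightarrow> (nat \<Rightarrow> nat) set" where
  "sep_states N K = {1..N} \<rightarrow>\<^sub>E {0..K}"

text \<open>The three summands are the arrivals, the departures and the hops from site \<open>i\<close> to site \<open>j\<close>.\<close>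

definition sep_rate ::
  "nat \<Rightarrow> nat \<Rightarrow> (nat \<Rightarrow> real) \<Rightarrow> (nat \<Rightarrow> real) \<Rightarrow> (nat \<Rightarrow> real) \<Rightarrow>
   (nat \<Rightarrow> nat) \<Rightarrow> (nat \<Rightarrow> nat) \<Rightarrow> real" where
  "sep_rate N K \<alpha> \<beta> \<delta> x y =
     (\<Sum>k\<in>{1..K}.
        (\<Sum>i\<in>{1, N}. if x i = 0 \<and> y = x(i := k) then \<alpha> k else 0) +
        (\<Sum>i\<in>{1, N}. if x i = k \<and> y = x(i := 0) then \<beta> k else 0) +
        (\<Sum>i\<in>{1..N}. \<Sum>j\<in>{1..N}.
           if \<bar>int i - int j\<bar> = 1 \<and> x i = k \<and> x j = 0 \<and> y = x(i := 0, j := k) then \<delta> k else 0))"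

text \<open>In \<open>arrival_times\<close>, \<open>x\<close> is the state immediately before the jump.  An arrival changes
  the state of exactly one site and a hop that of two, so for \<open>N \<ge> 2\<close> each such time corresponds
  to exactly one particle of type \<open>k\<close> entering from outside.\<close>

definition arrival_times ::
  "nat \<Rightarrow> nat \<Rightarrow> (real \<Rightarrow> nat \<Rightarrow> nat) \<Rightarrow> real \<Rightarrow> real \<Rightarrow> real set" where
  "arrival_times N k f s t =
     {u. s < u \<and> u \<le> t \<and>
         (\<exists>x. (\<forall>\<^sub>F v in at_left u. f v = x) \<and>
              (\<exists>i\<in>{1, N}. x i = 0 \<and> f u = x(i := k)))}"

definition arrival_rate ::
  "nat \<Rightarrow> nat \<Rightarrow> 'w measure \<Rightarrow> (real \<Rightarrow> 'w \<Rightarrow> nat \<Rightarrow> nat) \<Rightarrow> real \<Rightarrow> real \<Rightarrow> real" where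
  "arrival_rate N k M X s t =
     prob_space.expectation M (\<lambda>\<omega>. real (card (arrival_times N k (\<lambda>u. X u \<omega>) s t))) / (t - s)"

end

theory Submission
  imports Defs
begin

text \<open>The chain is reversible with respect to the product measure whose marginals give weight
  proportional to \<open>1\<close> to a vacancy and to \<open>\<alpha> l / \<beta> l\<close> to a particle of type \<open>l\<close>, and since the
  empty configuration is accessible from everywhere this is the only stationary distribution.  So
  sites \<open>1\<close> and \<open>N\<close> are each vacant with probability \<open>1 / (1 + (\<Sum>l. \<alpha> l / \<beta> l))\<close>, and while vacant
  they receive particles of type \<open>k\<close> at rate \<open>\<alpha> k\<close>.  That the expected number of jumps of a given
  kind is the time integral of their rate follows by observing the path on dyadic grids: there the
  expectation is computed from the transition function, and on each path the count of observed
  changes is eventually the count of jumps.\<close>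

section \<open>Jumps of a path\<close>

text \<open>The left limit is discrete: the path must be constant just before \<open>u\<close>.
  Half-open intervals make the counts additive over adjacent intervals.\<close>

definition jump_times :: "('s \<Rightarrow> 's \<Rightarrow> bool) \<Rightarrow> (real \<Rightarrow> 's) \<Rightarrow> real \<Rightarrow> real \<Rightarrow> real set" where
  "jump_times R f a b =
     {u. a < u \<and> u \<le> b \<and> (\<exists>x. (\<forall>\<^sub>F v in at_left u. f v = x) \<and> R x (f u))}"

lemma jump_timesI:
  "a < u \<Longrightarrow> u \<le> b \<Longrightarrow> (\<forall>\<^sub>F v in at_left u. f v = x) \<Longrightarrow> R x (f u) \<Longrightarrow> u \<in> jump_times R f a b"
  unfolding jump_times_def by blast

lemma jump_times_split:
  assumes "a \<le> b" "b \<le> c"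
  shows "jump_times R f a c = jump_times R f a b \<union> jump_times R f b c"
    and "jump_times R f a b \<inter> jump_times R f b c = {}"
  using assms unfolding jump_times_def by auto

lemma eventually_at_left_const:
  fixes f :: "real \<Rightarrow> 's"
  assumes "p < u" and "\<And>v. p \<le> v \<Longrightarrow> v < u \<Longrightarrow> f v = x"
  shows "\<forall>\<^sub>F v in at_left u. f v = x"
  unfolding eventually_at_left_field using assms by (intro exI[of _ p]) auto

lemma eventually_at_left_unique:
  fixes f :: "real \<Rightarrow> 's"
  assumes "\<forall>\<^sub>F v in at_left u. f v = x" and "\<forall>\<^sub>F v in at_left u. f v = y"
  shows "x = y"
proof -
  have "\<forall>\<^sub>F v in at_left u. x = y"
    using assms by eventually_elim auto
  then show ?thesis by (simp add: eventually_const_iff)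
qed

text \<open>The only point where the path can change is \<open>c\<close>, and irreflexivity excludes
  points of constancy. If \<open>c\<close> lies at or before \<open>p\<close>, or after
  \<open>q\<close>, the path is constant on the whole interval and both sides vanish.\<close>

lemma card_jump_times_single:
  fixes f :: "real \<Rightarrow> 's"
  assumes irrefl: "irreflp R" and pq: "p \<le> q"
    and left: "\<And>u. p \<le> u \<Longrightarrow> u \<le> q \<Longrightarrow> u < c \<Longrightarrow> f u = x"
    and right: "\<And>u. p \<le> u \<Longrightarrow> u \<le> q \<Longrightarrow> c \<le> u \<Longrightarrow> f u = y"
  shows "finite (jump_times R f p q) \<and> card (jump_times R f p q) = of_bool (R (f p) (f q))"
proof -
  have sub: "u = c \<and> R x y \<and> p < c \<and> c \<le> q" if u: "u \<in> jump_times R f p q" for u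
  proof -
    obtain z where uz: "p < u" "u \<le> q" "\<forall>\<^sub>F v in at_left u. f v = z" "R z (f u)"
      using u unfolding jump_times_def by blast
    consider "u < c" | "u = c" | "c < u" by linarith
    then show ?thesis
    proof cases
      case 1
      have "z = x"
        using uz 1 by (intro eventually_at_left_unique[OF uz(3)] eventually_at_left_const[of p]) (auto intro: left)
      moreover have "f u = x" using left[of u] uz 1 by simp
      ultimately show ?thesis using uz irreflpD[OF irrefl] by blast
    next
      case 2
      have "z = x"
        using uz 2 by (intro eventually_at_left_unique[OF uz(3)] eventually_at_left_const[of p]) (auto intro: left)
      moreover have "f u = y" using right[of u] uz 2 by simp
      ultimately show ?thesis using uz 2 by auto
    next
      case 3
      \<comment> \<open>To the left of \<open>u\<close> the value \<open>y\<close> is guaranteed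
        only from \<open>c\<close> on and only inside the interval, hence the bound
        \<open>max p c\<close>.\<close>
      have "z = y"
        using uz 3
        by (intro eventually_at_left_unique[OF uz(3)] eventually_at_left_const[of "max p c"]) (auto intro: right)
      moreover have "f u = y" using right[of u] uz 3 by simp
      ultimately show ?thesis using uz irreflpD[OF irrefl] by blast
    qed
  qed
  show ?thesis
  proof (cases "R (f p) (f q)")
    case True
    then have ne: "f p \<noteq> f q" using irreflpD[OF irrefl] by metis
    have c: "p < c" "c \<le> q"
    proof -
      show "p < c" using ne right[of p] right[of q] pq by (cases "p < c") auto
      show "c \<le> q" using ne left[of p] left[of q] pq by (cases "c \<le> q") auto
    qed
    have "f p = x" "f q = y" "f c = y" using c pq left[of p] right[of q] right[of c] by auto
    then have "R x (f c)" using True by simp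
    moreover have "\<forall>\<^sub>F v in at_left c. f v = x"
      using c by (intro eventually_at_left_const[OF c(1)] left) auto
    ultimately have "c \<in> jump_times R f p q" using c by (intro jump_timesI)
    then have "jump_times R f p q = {c}" using sub by blast
    then show ?thesis using True by simp
  next
    case False
    have "jump_times R f p q = {}"
    proof (rule ccontr)
      assume "jump_times R f p q \<noteq> {}"
      then have "R x y" "p < c" "c \<le> q" using sub by blast+
      then show False using False left[of p] right[of q] by auto
    qed
    then show ?thesis using False by simp
  qed
qed

text \<open>Half-open intervals are disjoint, so cardinalities add. The inequality
  \<open>ts 0 \<le> ts n\<close> is carried through the induction because splitting at
  \<open>ts n\<close> requires it.\<close>

lemma card_jump_times_partition:
  fixes f :: "real \<Rightarrow> 's"
  assumes "\<And>j. j < n \<Longrightarrow> ts j \<le> ts (Suc j)"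
    and "\<And>j. j < n \<Longrightarrow> finite (jump_times R f (ts j) (ts (Suc j))) \<and>
           card (jump_times R f (ts j) (ts (Suc j))) = of_bool (R (f (ts j)) (f (ts (Suc j))))"
  shows "finite (jump_times R f (ts 0) (ts n)) \<and> ts 0 \<le> ts n \<and>
    card (jump_times R f (ts 0) (ts n)) = (\<Sum>j<n. of_bool (R (f (ts j)) (f (ts (Suc j)))))"
  using assms
proof (induction n)
  case 0
  have "jump_times R f (ts 0) (ts 0) = {}" unfolding jump_times_def by auto
  then show ?case by simp
next
  case (Suc n)
  have IH: "finite (jump_times R f (ts 0) (ts n))" "ts 0 \<le> ts n"
    "card (jump_times R f (ts 0) (ts n)) = (\<Sum>j<n. of_bool (R (f (ts j)) (f (ts (Suc j)))))"
    using Suc by auto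
  have le: "ts n \<le> ts (Suc n)" using Suc.prems(1) by simp
  show ?case
    using IH le Suc.prems(2)[of n] jump_times_split[OF IH(2) le, of R f]
    by (auto simp: card_Un_disjoint)
qed

section \<open>Counting changes along dyadic grids\<close>

definition dyadic :: "real \<Rightarrow> real \<Rightarrow> nat \<Rightarrow> nat \<Rightarrow> real" where
  "dyadic a b m j = a + (b - a) * real j / 2 ^ m"

lemma dyadic_0 [simp]: "dyadic a b m 0 = a"
  and dyadic_top [simp]: "dyadic a b m (2 ^ m) = b"
  by (simp_all add: dyadic_def)

lemma dyadic_diff: "dyadic a b m (Suc j) - dyadic a b m j = (b - a) / 2 ^ m"
  by (simp add: dyadic_def field_simps)

lemma dyadic_Suc_double [simp]: "dyadic a b (Suc m) (2 * j) = dyadic a b m j"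
  by (simp add: dyadic_def field_simps)

lemma dyadic_mono:
  assumes "a \<le> b" "i \<le> j"
  shows "dyadic a b m i \<le> dyadic a b m j"
  using assms unfolding dyadic_def by (simp add: divide_right_mono mult_left_mono)

lemma dyadic_bounds:
  assumes "a \<le> b" "j \<le> 2 ^ m"
  shows "a \<le> dyadic a b m j" "dyadic a b m j \<le> b"
  using dyadic_mono[OF assms(1), of 0 j m] dyadic_mono[OF assms, of m] by auto

definition dyadic_count :: "('s \<Rightarrow> 's \<Rightarrow> bool) \<Rightarrow> (real \<Rightarrow> 's) \<Rightarrow> real \<Rightarrow> real \<Rightarrow> nat \<Rightarrow> nat" where
  "dyadic_count R f a b m =
     (\<Sum>j<2 ^ m. of_bool (R (f (dyadic a b m j)) (f (dyadic a b m (Suc j)))))"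

lemma dyadic_count_le_neq:
  assumes "irreflp R"
  shows "dyadic_count R f a b m \<le> dyadic_count (\<noteq>) f a b m"
  unfolding dyadic_count_def using assms by (intro sum_mono) (auto simp: of_bool_def irreflp_def)

text \<open>If the path differs at the ends of an interval, it differs across at least one of the
  two halves. A general relation \<open>R\<close> has no such property, so monotonicity is available
  only for the count of all changes.\<close>

lemma dyadic_count_neq_mono: "dyadic_count (\<noteq>) f a b m \<le> dyadic_count (\<noteq>) f a b (Suc m)"
proof -
  define g where "g j = (of_bool (f (dyadic a b (Suc m) j) \<noteq> f (dyadic a b (Suc m) (Suc j))) :: nat)" for j
  have split: "(\<Sum>j<2 * n. g j) = (\<Sum>j<n. g (2 * j) + g (Suc (2 * j)))" for n
    by (induction n) auto
  have "dyadic_count (\<noteq>) f a b m \<le> (\<Sum>j<2 ^ m. g (2 * j) + g (Suc (2 * j)))"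
    unfolding dyadic_count_def
  proof (rule sum_mono)
    fix j
    have "dyadic a b m (Suc j) = dyadic a b (Suc m) (Suc (Suc (2 * j)))"
      using dyadic_Suc_double[of a b m "Suc j"] by simp
    then show "of_bool (f (dyadic a b m j) \<noteq> f (dyadic a b m (Suc j))) \<le> g (2 * j) + g (Suc (2 * j))"
      unfolding g_def by (auto simp: of_bool_def)
  qed
  also have "\<dots> = dyadic_count (\<noteq>) f a b (Suc m)"
    unfolding split[symmetric] unfolding dyadic_count_def g_def by (simp only: power_Suc)
  finally show ?thesis .
qed

lemma eventually_card_jump_times:
  fixes f :: "real \<Rightarrow> 's"
  assumes irrefl: "irreflp R" and ab: "a < b"
    and right: "\<And>u. a \<le> u \<Longrightarrow> u \<le> b \<Longrightarrow> \<forall>\<^sub>F v in at_right u. f v = f u"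
    and left: "\<And>u. a < u \<Longrightarrow> u \<le> b \<Longrightarrow> \<exists>y. \<forall>\<^sub>F v in at_left u. f v = y"
  shows "\<forall>\<^sub>F m in sequentially. card (jump_times R f a b) = dyadic_count R f a b m"
proof -
  txt \<open>Near each point \<open>u\<close> the path is constant before \<open>u\<close> and from \<open>u\<close> on; by compactness
    every sufficiently short interval lies in one of these neighbourhoods.\<close>
  define near where "near u e x \<longleftrightarrow> 0 < e \<and>
      (\<forall>v. a \<le> v \<and> v \<le> b \<and> u - e < v \<and> v < u \<longrightarrow> f v = x) \<and>
      (\<forall>v. a \<le> v \<and> v \<le> b \<and> u \<le> v \<and> v < u + e \<longrightarrow> f v = f u)" for u e x
  have "\<exists>e x. near u e x" if u: "u \<in> {a..b}" for u
  proof -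
    obtain r where r: "r > u" "\<And>v. u < v \<Longrightarrow> v < r \<Longrightarrow> f v = f u"
      using right[of u] u unfolding eventually_at_right_field by auto
    obtain l x where l: "l < u" "\<And>v. l < v \<Longrightarrow> v < u \<Longrightarrow> a \<le> v \<Longrightarrow> f v = x"
    proof (cases "u = a")
      case True
      \<comment> \<open>At the left endpoint no left limit is assumed; no point of the interval lies
        before it, so the claim is vacuous for any \<open>l < a\<close>.\<close>
      then show ?thesis by (intro that[of "a - 1"]) auto
    next
      case False
      then obtain y where "\<forall>\<^sub>F v in at_left u. f v = y" using left[of u] u by auto
      then show ?thesis unfolding eventually_at_left_field using that by auto
    qed
    define e where "e = min (r - u) (u - l)"
    show ?thesis
      unfolding near_def
    proof (intro exI[of _ e] exI[of _ x] conjI allI impI)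
      show "0 < e" using r l by (simp add: e_def)
    next
      fix v assume "a \<le> v \<and> v \<le> b \<and> u - e < v \<and> v < u"
      then show "f v = x" using l(2)[of v] by (auto simp: e_def)
    next
      fix v assume "a \<le> v \<and> v \<le> b \<and> u \<le> v \<and> v < u + e"
      then show "f v = f u" using r(2)[of v] by (cases "u = v") (auto simp: e_def)
    qed
  qed
  then obtain e x where near: "\<And>u. u \<in> {a..b} \<Longrightarrow> near u (e u) (x u)"
    by metis
  have e: "e u > 0" if "u \<in> {a..b}" for u
    using near[OF that] unfolding near_def by blast
  have ex: "f v = x u" if "u \<in> {a..b}" "a \<le> v" "v \<le> b" "u - e u < v" "v < u" for u v
    using near[OF that(1)] that unfolding near_def by blast
  have ey: "f v = f u" if "u \<in> {a..b}" "a \<le> v" "v \<le> b" "u \<le> v" "v < u + e u" for u v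
    using near[OF that(1)] that unfolding near_def by blast
  \<comment> \<open>This \<open>d\<close> is a Lebesgue number of the cover by the balls
    \<open>ball u (e u)\<close>.\<close>
  have "\<exists>d>0. \<forall>p\<in>{a..b}. \<exists>B\<in>((\<lambda>u. ball u (e u)) ` {a..b}). ball p d \<subseteq> B"
  proof (rule Heine_Borel_lemma[of "{a..b}" "(\<lambda>u. ball u (e u)) ` {a..b}"])
    show "{a..b} \<subseteq> \<Union> ((\<lambda>u. ball u (e u)) ` {a..b})"
    proof
      fix u assume u: "u \<in> {a..b}"
      then have "u \<in> ball u (e u)" using e by simp
      with u show "u \<in> \<Union> ((\<lambda>u. ball u (e u)) ` {a..b})" by blast
    qed
  qed auto
  then obtain d where d: "d > 0"
    and cov: "\<And>p. p \<in> {a..b} \<Longrightarrow> \<exists>u\<in>{a..b}. ball p d \<subseteq> ball u (e u)"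
    by blast
  have "(\<lambda>m. (b - a) * (1 / 2) ^ m) \<longlonglongrightarrow> (b - a) * 0"
    by (intro tendsto_intros) auto
  then have "\<forall>\<^sub>F m in sequentially. (b - a) * (1 / 2) ^ m < d"
    using d by (intro order_tendstoD) auto
  then show ?thesis
  proof eventually_elim
    case (elim m)
    let ?t = "dyadic a b m"
    have single: "finite (jump_times R f (?t j) (?t (Suc j))) \<and>
        card (jump_times R f (?t j) (?t (Suc j))) = of_bool (R (f (?t j)) (f (?t (Suc j))))"
      if j: "j < 2 ^ m" for j
    proof -
      have t: "a \<le> ?t j" "?t j \<le> b" "a \<le> ?t (Suc j)" "?t (Suc j) \<le> b" "?t j \<le> ?t (Suc j)"
        using dyadic_bounds[of a b j m] dyadic_bounds[of a b "Suc j" m] dyadic_mono[of a b j "Suc j" m] ab j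
        by simp_all
      have len: "?t (Suc j) < ?t j + d"
      proof -
        have "(b - a) / 2 ^ m < d" using elim by (simp add: power_one_over)
        then show ?thesis using dyadic_diff[of a b m j] by linarith
      qed
      obtain u where u: "u \<in> {a..b}" "ball (?t j) d \<subseteq> ball u (e u)"
        using cov[of "?t j"] t by auto
      have close: "u - e u < v" "v < u + e u" if "?t j \<le> v" "v \<le> ?t (Suc j)" for v
      proof -
        have "v \<in> ball (?t j) d" using that len by (simp add: dist_real_def)
        then have "v \<in> ball u (e u)" using u by blast
        then show "u - e u < v" "v < u + e u" by (auto simp: dist_real_def)
      qed
      show ?thesis
      \<comment> \<open>The centre of the ball is the only possible jump point; it need not lie in
        the grid interval itself.\<close>
      proof (rule card_jump_times_single[where c = u and x = "x u" and y = "f u", OF irrefl t(5)])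
        fix v assume v: "?t j \<le> v" "v \<le> ?t (Suc j)"
        show "f v = x u" if "v < u" using ex[OF u(1), of v] close[of v] v t that by auto
        show "f v = f u" if "u \<le> v" using ey[OF u(1), of v] close[of v] v t that by auto
      qed
    qed
    have "card (jump_times R f (?t 0) (?t (2 ^ m))) =
        (\<Sum>j<2 ^ m. of_bool (R (f (?t j)) (f (?t (Suc j)))))"
    proof (intro card_jump_times_partition[THEN conjunct2, THEN conjunct2] single)
      show "?t j \<le> ?t (Suc j)" for j using ab by (simp add: dyadic_mono)
    qed
    then show ?case by (simp add: dyadic_count_def)
  qed
qed

section \<open>Transition functions and stationary distributions\<close>

text \<open>A crude bound by the total absolute mass of the generator, enough to compare the matrix
  exponential with a scalar exponential series.\<close>

lemma generator_power_bound:
  assumes "finite S" "x \<in> S"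
  shows "\<bar>generator_power S q n x y\<bar> \<le> (\<Sum>x\<in>S. \<Sum>z\<in>S. \<bar>generator S q x z\<bar>) ^ n"
    (is "_ \<le> ?C ^ n")
  using assms(2)
proof (induction n arbitrary: x)
  case 0
  then show ?case by simp
next
  case (Suc n)
  have C: "0 \<le> ?C" by (intro sum_nonneg) auto
  have "\<bar>generator_power S q (Suc n) x y\<bar> \<le> (\<Sum>z\<in>S. \<bar>generator S q x z\<bar> * ?C ^ n)"
    using Suc.IH by (auto intro!: order_trans[OF sum_abs] sum_mono mult_left_mono simp: abs_mult)
  also have "\<dots> = (\<Sum>z\<in>S. \<bar>generator S q x z\<bar>) * ?C ^ n"
    by (simp add: sum_distrib_right)
  also have "\<dots> \<le> ?C * ?C ^ n"
  proof (rule mult_right_mono)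
    show "(\<Sum>z\<in>S. \<bar>generator S q x z\<bar>) \<le> ?C"
      using assms(1) Suc.prems
      by (intro member_le_sum[of x S "\<lambda>x. \<Sum>z\<in>S. \<bar>generator S q x z\<bar>"]) (auto intro: sum_nonneg)
  qed (use C in simp)
  finally show ?case by simp
qed

lemma transition_function_0: "transition_function S q 0 x y = (if x = y then 1 else 0)"
proof -
  have "transition_function S q 0 x y = (\<Sum>n. (generator_power S q n x y / fact n) * 0 ^ n)"
    unfolding transition_function_def by (simp add: field_simps)
  also have "\<dots> = generator_power S q 0 x y / fact 0"
    by (rule powser_zero)
  finally show ?thesis by simp
qed

text \<open>Each entry is a power series in \<open>t\<close>, so its derivative at 0 is the linear
  coefficient.\<close>

lemma transition_function_deriv:
  assumes "finite S" "x \<in> S" "y \<in> S"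
  shows "((\<lambda>t. transition_function S q t x y) has_real_derivative generator S q x y) (at 0)"
proof -
  let ?C = "\<Sum>x\<in>S. \<Sum>z\<in>S. \<bar>generator S q x z\<bar>"
  define c where "c n = generator_power S q n x y / fact n" for n
  \<comment> \<open>Convergence at 1 allows termwise differentiation inside the unit disc, in
    particular at 0.\<close>
  have "summable (\<lambda>n. c n * 1 ^ n)"
  proof (rule summable_comparison_test)
    show "\<exists>N. \<forall>n\<ge>N. norm (c n * 1 ^ n) \<le> ?C ^ n /\<^sub>R fact n"
    proof (intro exI allI impI)
      fix n
      show "norm (c n * 1 ^ n) \<le> ?C ^ n /\<^sub>R fact n"
        using generator_power_bound[OF assms(1,2), of q n y]
        by (simp add: c_def divide_inverse mult.commute abs_mult mult_left_mono)
    qed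
    show "summable (\<lambda>n. ?C ^ n /\<^sub>R fact n)" by (rule summable_exp_generic)
  qed
  then have "((\<lambda>t. \<Sum>n. c n * t ^ n) has_real_derivative (\<Sum>n. diffs c n * 0 ^ n)) (at 0)"
    by (rule termdiffs_strong) auto
  moreover have "(\<Sum>n. diffs c n * 0 ^ n) = generator S q x y"
    unfolding powser_zero using assms by (simp add: diffs_def c_def if_distrib[of "(*) _"] sum.delta cong: if_cong)
  moreover have "(\<lambda>t. \<Sum>n. c n * t ^ n) = (\<lambda>t. transition_function S q t x y)"
    unfolding transition_function_def c_def by (simp add: field_simps)
  ultimately show ?thesis by simp
qed

text \<open>Differentiating the invariance under the transition function at time 0 gives the global
  balance equations.\<close>

lemma stationary_distribution_generator:
  assumes fin: "finite S" and stat: "stationary_distribution S q \<pi>" and y: "y \<in> S"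
  shows "(\<Sum>x\<in>S. \<pi> x * generator S q x y) = 0"
proof -
  let ?g = "\<lambda>t. \<Sum>x\<in>S. \<pi> x * transition_function S q t x y"
  have "(?g has_real_derivative (\<Sum>x\<in>S. \<pi> x * generator S q x y)) (at 0)"
    by (intro DERIV_sum DERIV_cmult transition_function_deriv fin y)
  then have "((\<lambda>h. (?g (0 + h) - ?g 0) / h) \<longlongrightarrow> (\<Sum>x\<in>S. \<pi> x * generator S q x y)) (at 0)"
    unfolding DERIV_def .
  \<comment> \<open>Invariance is known for nonnegative times only, so the difference quotient is
    examined from the right.\<close>
  then have lim: "((\<lambda>h. (?g (0 + h) - ?g 0) / h) \<longlongrightarrow> (\<Sum>x\<in>S. \<pi> x * generator S q x y)) (at_right 0)"
    by (rule tendsto_mono[rotated]) (simp add: at_le)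
  have "\<forall>\<^sub>F h in at_right 0. (?g (0 + h) - ?g 0) / h = 0"
    using eventually_at_right_less[of "0::real"]
  proof eventually_elim
    case (elim h)
    have "?g t = \<pi> y" if "t \<ge> 0" for t
      using stat y that unfolding stationary_distribution_def by blast
    from this[of h] this[of 0] elim show ?case by simp
  qed
  then have "((\<lambda>h. (?g (0 + h) - ?g 0) / h) \<longlongrightarrow> 0) (at_right 0)"
    by (rule tendsto_eventually)
  with lim show ?thesis by (rule tendsto_unique[rotated]) simp
qed

text \<open>The ratio \<open>f = \<pi> / p\<close> is harmonic for the conductances \<open>p x * q x y\<close>; summing the
  harmonicity equations against \<open>f\<close> shows that its Dirichlet energy is zero.\<close>

lemma reversible_stationary_ratio:
  fixes p \<pi> :: "'s \<Rightarrow> real"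
  assumes fin: "finite S"
    and pos: "\<And>x. x \<in> S \<Longrightarrow> 0 < p x"
    and q_nonneg: "\<And>x y. x \<in> S \<Longrightarrow> y \<in> S \<Longrightarrow> 0 \<le> q x y"
    and rev: "\<And>x y. x \<in> S \<Longrightarrow> y \<in> S \<Longrightarrow> p x * q x y = p y * q y x"
    and stat: "\<And>y. y \<in> S \<Longrightarrow> (\<Sum>x\<in>S. \<pi> x * generator S q x y) = 0"
    and x: "x \<in> S" and y: "y \<in> S" and xy: "0 < q x y"
  shows "\<pi> x / p x = \<pi> y / p y"
proof -
  define f where "f x = \<pi> x / p x" for x
  define c where "c x y = p x * q x y" for x y
  have c_sym: "c x y = c y x" if "x \<in> S" "y \<in> S" for x y
    using rev that unfolding c_def by simp
  have harm: "(\<Sum>x\<in>S. c x y * (f x - f y)) = 0" if y: "y \<in> S" for y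
  proof -
    have eq: "\<pi> x * q x y = c x y * f x" "\<pi> y * q y x = c x y * f y" if "x \<in> S" for x
      using pos[OF that] pos[OF y] c_sym[OF that y] unfolding f_def c_def by (auto simp: field_simps)
    have "0 = (\<Sum>x\<in>S. \<pi> x * generator S q x y)" using stat[OF y] by simp
    also have "\<dots> = (\<Sum>x\<in>S - {y}. \<pi> x * q x y) - \<pi> y * (\<Sum>x\<in>S - {y}. q y x)"
      using fin y by (subst sum.remove[of _ y]) (auto simp: generator_def intro!: sum.cong)
    also have "\<dots> = (\<Sum>x\<in>S - {y}. \<pi> x * q x y - \<pi> y * q y x)"
      by (simp add: sum_distrib_left sum_subtractf)
    also have "\<dots> = (\<Sum>x\<in>S - {y}. c x y * (f x - f y))"
      by (intro sum.cong) (auto simp: eq algebra_simps)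
    \<comment> \<open>The diagonal term vanishes through the factor \<open>f y - f y\<close>,
      whatever \<open>q y y\<close> is.\<close>
    also have "\<dots> = (\<Sum>x\<in>S. c x y * (f x - f y))"
      using fin y by (subst (2) sum.remove[of _ y]) auto
    finally show ?thesis by simp
  qed
  have A: "(\<Sum>y\<in>S. \<Sum>x\<in>S. c x y * (f x - f y) * f y) = 0"
    using harm by (simp add: sum_distrib_right[symmetric])
  \<comment> \<open>Exchanging the roles of \<open>x\<close> and \<open>y\<close> flips the sign of
    \<open>f x - f y\<close> and keeps \<open>c\<close>, so this sum is the negative of the one in
    \<open>A\<close>.\<close>
  have B: "(\<Sum>y\<in>S. \<Sum>x\<in>S. c x y * (f x - f y) * f x) = 0"
  proof -
    have "(\<Sum>y\<in>S. \<Sum>x\<in>S. c x y * (f x - f y) * f x) = (\<Sum>x\<in>S. \<Sum>y\<in>S. c x y * (f x - f y) * f x)"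
      by (rule sum.swap)
    also have "\<dots> = (\<Sum>x\<in>S. \<Sum>y\<in>S. - (c y x * (f y - f x) * f x))"
      by (intro sum.cong refl) (auto simp: c_sym algebra_simps)
    also have "\<dots> = 0" using A by (simp add: sum_negf)
    finally show ?thesis .
  qed
  have "(\<Sum>y\<in>S. \<Sum>x\<in>S. c x y * (f x - f y)\<^sup>2) =
      (\<Sum>y\<in>S. \<Sum>x\<in>S. c x y * (f x - f y) * f x) - (\<Sum>y\<in>S. \<Sum>x\<in>S. c x y * (f x - f y) * f y)"
    by (simp add: sum_subtractf[symmetric] power2_eq_square algebra_simps)
  then have "(\<Sum>y\<in>S. \<Sum>x\<in>S. c x y * (f x - f y)\<^sup>2) = 0" using A B by simp
  moreover have nonneg: "0 \<le> c x y * (f x - f y)\<^sup>2" if "x \<in> S" "y \<in> S" for x y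
    using pos[OF that(1)] q_nonneg[OF that] unfolding c_def by simp
  ultimately have "c x y * (f x - f y)\<^sup>2 = 0"
    using fin x y by (auto simp: sum_nonneg_eq_0_iff sum_nonneg)
  then show ?thesis using pos[OF x] xy unfolding c_def f_def by auto
qed

section \<open>Expected number of jumps\<close>

locale stationary_chain =
  fixes S :: "'s set" and q :: "'s \<Rightarrow> 's \<Rightarrow> real"
    and M :: "'w measure" and X :: "real \<Rightarrow> 'w \<Rightarrow> 's" and \<pi> :: "'s \<Rightarrow> real"
  assumes finite_S: "finite S"
    and chain: "markov_chain S q M X"
    and stationary: "stationary_distribution S q \<pi>"
    and initial: "\<And>x. \<pi> x = measure M {\<omega> \<in> space M. X 0 \<omega> = x}"
begin

sublocale prob_space M
  using chain unfolding markov_chain_def by blast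

lemma X_measurable: "0 \<le> t \<Longrightarrow> X t \<in> measurable M (count_space S)"
  using chain unfolding markov_chain_def by blast

lemma X_in: "0 \<le> t \<Longrightarrow> \<omega> \<in> space M \<Longrightarrow> X t \<omega> \<in> S"
  using measurable_space[OF X_measurable] by simp

lemma X_right: "0 \<le> t \<Longrightarrow> \<omega> \<in> space M \<Longrightarrow> \<forall>\<^sub>F u in at_right t. X u \<omega> = X t \<omega>"
  and X_left: "0 < t \<Longrightarrow> \<omega> \<in> space M \<Longrightarrow> \<exists>y. \<forall>\<^sub>F u in at_left t. X u \<omega> = y"
  using chain unfolding markov_chain_def by blast+

text \<open>Finiteness of the state space makes the event a finite union of events fixing both
  values, so any \<open>P\<close> is allowed.\<close>

lemma X_sets:
  assumes "0 \<le> a" "0 \<le> b"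
  shows "{\<omega> \<in> space M. P (X a \<omega>) (X b \<omega>)} \<in> sets M"
proof -
  have [measurable]: "X a \<in> measurable M (count_space S)" "X b \<in> measurable M (count_space S)"
    using X_measurable assms by auto
  have "{\<omega> \<in> space M. P (X a \<omega>) (X b \<omega>)} =
      (\<Union>x\<in>S. \<Union>y\<in>{y\<in>S. P x y}. {\<omega> \<in> space M. X a \<omega> = x} \<inter> {\<omega> \<in> space M. X b \<omega> = y})"
    using X_in assms by auto
  also have "\<dots> \<in> sets M"
    using finite_S by (intro sets.finite_UN sets.Int) auto
  finally show ?thesis .
qed

lemma markov_pair:
  assumes "0 \<le> a" "a \<le> b" "x \<in> S" "y \<in> S"
  shows "prob {\<omega> \<in> space M. X a \<omega> = x \<and> X b \<omega> = y} =
    prob {\<omega> \<in> space M. X a \<omega> = x} * transition_function S q (b - a) x y"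
proof -
  \<comment> \<open>The Markov property is used with \<open>n = 0\<close>, where only the first two
    times and states matter.\<close>
  define ts where "ts i = (if i = 0 then a else b)" for i :: nat
  define xs where "xs i = (if i = 0 then x else y)" for i :: nat
  have "prob {\<omega> \<in> space M. \<forall>i\<le>Suc 0. X (ts i) \<omega> = xs i} =
      prob {\<omega> \<in> space M. \<forall>i\<le>0. X (ts i) \<omega> = xs i} *
        transition_function S q (ts (Suc 0) - ts 0) (xs 0) (xs (Suc 0))"
    using chain assms unfolding markov_chain_def
    by (elim conjE allE[of _ "0::nat"] allE[of _ ts] allE[of _ xs]) (auto simp: ts_def xs_def)
  moreover have "(\<forall>i\<le>Suc 0. X (ts i) \<omega> = xs i) \<longleftrightarrow> X a \<omega> = x \<and> X b \<omega> = y" for \<omega>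
    by (auto simp: ts_def xs_def le_Suc_eq)
  ultimately show ?thesis by (simp add: ts_def xs_def)
qed

text \<open>Splitting by the initial state turns the law at time \<open>t\<close> into the initial
  law times the transition function, which invariance collapses.\<close>

lemma prob_X:
  assumes "0 \<le> t" "y \<in> S"
  shows "prob {\<omega> \<in> space M. X t \<omega> = y} = \<pi> y"
proof -
  have "prob {\<omega> \<in> space M. X t \<omega> = y} = prob (\<Union>x\<in>S. {\<omega> \<in> space M. X 0 \<omega> = x \<and> X t \<omega> = y})"
    using X_in[of 0] by (intro arg_cong[of _ _ prob]) auto
  also have "\<dots> = (\<Sum>x\<in>S. prob {\<omega> \<in> space M. X 0 \<omega> = x \<and> X t \<omega> = y})"
    using finite_S X_sets[of 0 t "\<lambda>u v. u = _ \<and> v = y"] assms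
    by (intro finite_measure_finite_Union) (auto simp: disjoint_family_on_def)
  also have "\<dots> = (\<Sum>x\<in>S. \<pi> x * transition_function S q t x y)"
    using assms markov_pair[of 0 t] initial by (intro sum.cong) auto
  also have "\<dots> = \<pi> y"
    using stationary assms unfolding stationary_distribution_def by blast
  finally show ?thesis .
qed

lemma prob_pair:
  assumes "0 \<le> a" "a \<le> b"
  shows "prob {\<omega> \<in> space M. R (X a \<omega>) (X b \<omega>)} =
    (\<Sum>x\<in>S. \<Sum>y\<in>{y\<in>S. R x y}. \<pi> x * transition_function S q (b - a) x y)"
proof -
  have b: "0 \<le> b" using assms by simp
  let ?I = "SIGMA x:S. {y\<in>S. R x y}"
  have "prob {\<omega> \<in> space M. R (X a \<omega>) (X b \<omega>)} =
      prob (\<Union>z\<in>?I. {\<omega> \<in> space M. X a \<omega> = fst z \<and> X b \<omega> = snd z})"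
    using X_in assms b by (intro arg_cong[of _ _ prob]) auto
  also have "\<dots> = (\<Sum>z\<in>?I. prob {\<omega> \<in> space M. X a \<omega> = fst z \<and> X b \<omega> = snd z})"
    using finite_S X_sets[of a b "\<lambda>u v. u = _ \<and> v = _"] assms b
    by (intro finite_measure_finite_Union) (auto simp: disjoint_family_on_def)
  also have "\<dots> = (\<Sum>z\<in>?I. \<pi> (fst z) * transition_function S q (b - a) (fst z) (snd z))"
    using assms markov_pair prob_X by (intro sum.cong) auto
  also have "\<dots> = (\<Sum>x\<in>S. \<Sum>y\<in>{y\<in>S. R x y}. \<pi> x * transition_function S q (b - a) x y)"
    using finite_S by (subst sum.Sigma) (auto simp: case_prod_beta)
  finally show ?thesis .
qed

context
  fixes s t :: real
  assumes s: "0 \<le> s" and st: "s < t"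
begin

text \<open>By stationarity and equal mesh, each of the \<open>2 ^ m\<close> grid intervals
  contributes the same probability to the expectation.\<close>

lemma dyadic_count_integrable:
  shows "integrable M (\<lambda>\<omega>. real (dyadic_count R (\<lambda>u. X u \<omega>) s t m))"
    and "expectation (\<lambda>\<omega>. real (dyadic_count R (\<lambda>u. X u \<omega>) s t m)) =
      2 ^ m * (\<Sum>x\<in>S. \<Sum>y\<in>{y\<in>S. R x y}. \<pi> x * transition_function S q ((t - s) / 2 ^ m) x y)"
proof -
  let ?E = "\<lambda>j. {\<omega> \<in> space M. R (X (dyadic s t m j) \<omega>) (X (dyadic s t m (Suc j)) \<omega>)}"
  have d: "0 \<le> dyadic s t m j" "dyadic s t m j \<le> dyadic s t m (Suc j)" for j
    using dyadic_mono[of s t 0 j m] dyadic_mono[of s t j "Suc j" m] s st by auto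
  have E: "?E j \<in> sets M" for j
    by (intro X_sets d)
  have eq: "real (dyadic_count R (\<lambda>u. X u \<omega>) s t m) = (\<Sum>j<2 ^ m. indicator (?E j) \<omega>)"
    if "\<omega> \<in> space M" for \<omega>
    unfolding dyadic_count_def of_nat_sum using that by (intro sum.cong) (auto simp: indicator_def)
  have int: "integrable M (\<lambda>\<omega>. \<Sum>j<2 ^ m. indicator (?E j) \<omega> :: real)"
    using E by (intro Bochner_Integration.integrable_sum integrable_real_indicator) (auto simp: emeasure_eq_measure)
  then show "integrable M (\<lambda>\<omega>. real (dyadic_count R (\<lambda>u. X u \<omega>) s t m))"
    by (subst Bochner_Integration.integrable_cong[OF refl eq])
  have "expectation (\<lambda>\<omega>. real (dyadic_count R (\<lambda>u. X u \<omega>) s t m)) =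
      expectation (\<lambda>\<omega>. \<Sum>j<2 ^ m. indicator (?E j) \<omega>)"
    by (intro Bochner_Integration.integral_cong refl eq)
  also have "\<dots> = (\<Sum>j<2 ^ m. prob (?E j))"
    using E by (subst Bochner_Integration.integral_sum) (auto simp: emeasure_eq_measure)
  also have "\<dots> = 2 ^ m * (\<Sum>x\<in>S. \<Sum>y\<in>{y\<in>S. R x y}. \<pi> x * transition_function S q ((t - s) / 2 ^ m) x y)"
    using prob_pair[OF d, of R] by (simp add: dyadic_diff)
  finally show "expectation (\<lambda>\<omega>. real (dyadic_count R (\<lambda>u. X u \<omega>) s t m)) = \<dots>" .
qed

text \<open>With mesh \<open>h m\<close>, the factor \<open>2 ^ m\<close> is
  \<open>(t - s) / h m\<close>, so a difference quotient of the transition function appears.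
  Irreflexivity leaves only off-diagonal entries, whose value at 0 is 0 and whose derivative is the
  jump rate.\<close>

lemma expectation_dyadic_count_limit:
  assumes irrefl: "irreflp R"
  shows "(\<lambda>m. expectation (\<lambda>\<omega>. real (dyadic_count R (\<lambda>u. X u \<omega>) s t m)))
    \<longlonglongrightarrow> (t - s) * (\<Sum>x\<in>S. \<Sum>y\<in>{y\<in>S. R x y}. \<pi> x * q x y)"
proof -
  define h where "h m = (t - s) / 2 ^ m" for m
  have h_pos: "h m \<noteq> 0" for m using st by (simp add: h_def)
  have "(\<lambda>m. (t - s) * (1 / 2) ^ m) \<longlonglongrightarrow> (t - s) * 0"
    by (intro tendsto_intros) auto
  then have "h \<longlonglongrightarrow> 0"
    unfolding h_def by (simp add: power_one_over)
  then have h: "filterlim h (at 0) sequentially"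
    using h_pos by (simp add: filterlim_at)
  have lim: "(\<lambda>m. 2 ^ m * transition_function S q (h m) x y) \<longlonglongrightarrow> (t - s) * q x y"
    if "x \<in> S" "y \<in> S" "R x y" for x y
  proof -
    have xy: "x \<noteq> y" using that(3) irreflpD[OF irrefl] by blast
    have "((\<lambda>u. transition_function S q u x y / u) \<longlongrightarrow> q x y) (at 0)"
      using transition_function_deriv[OF finite_S that(1,2), of q] xy
      by (simp add: DERIV_def transition_function_0 generator_def)
    from filterlim_compose[OF this h]
    have "(\<lambda>m. (t - s) * (transition_function S q (h m) x y / h m)) \<longlonglongrightarrow> (t - s) * q x y"
      by (intro tendsto_intros)
    moreover have "(t - s) * (z / h m) = 2 ^ m * z" for m z
      using st by (simp add: h_def field_simps)
    ultimately show ?thesis by simp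
  qed
  have "(\<lambda>m. \<Sum>x\<in>S. \<Sum>y\<in>{y\<in>S. R x y}. \<pi> x * (2 ^ m * transition_function S q (h m) x y))
      \<longlonglongrightarrow> (\<Sum>x\<in>S. \<Sum>y\<in>{y\<in>S. R x y}. \<pi> x * ((t - s) * q x y))"
    by (intro tendsto_sum tendsto_mult_left lim) auto
  then show ?thesis
    unfolding dyadic_count_integrable h_def[symmetric]
    by (simp add: sum_distrib_left mult.left_commute)
qed

text \<open>Observed along dyadic grids, the number of changes increases to the total number of
  jumps, which is therefore integrable by monotone convergence and dominates all counts.\<close>

theorem expectation_jump_times:
  assumes irrefl: "irreflp R"
  shows "expectation (\<lambda>\<omega>. real (card (jump_times R (\<lambda>u. X u \<omega>) s t))) =
    (t - s) * (\<Sum>x\<in>S. \<Sum>y\<in>{y\<in>S. R x y}. \<pi> x * q x y)"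
proof -
  have conv: "(\<lambda>m. real (dyadic_count R' (\<lambda>u. X u \<omega>) s t m))
      \<longlonglongrightarrow> real (card (jump_times R' (\<lambda>u. X u \<omega>) s t))"
    if irr: "irreflp R'" and \<omega>: "\<omega> \<in> space M" for R' \<omega>
  proof (rule tendsto_eventually)
    have "\<forall>\<^sub>F m in sequentially. card (jump_times R' (\<lambda>u. X u \<omega>) s t) = dyadic_count R' (\<lambda>u. X u \<omega>) s t m"
    proof (rule eventually_card_jump_times[OF irr st])
      show "\<forall>\<^sub>F v in at_right u. X v \<omega> = X u \<omega>" if "s \<le> u" for u
        using X_right[OF _ \<omega>, of u] s that by simp
      show "\<exists>y. \<forall>\<^sub>F v in at_left u. X v \<omega> = y" if "s < u" for u
        using X_left[OF _ \<omega>, of u] s that by simp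
    qed
    then show "\<forall>\<^sub>F m in sequentially. real (dyadic_count R' (\<lambda>u. X u \<omega>) s t m) =
        real (card (jump_times R' (\<lambda>u. X u \<omega>) s t))"
      by eventually_elim simp
  qed
  \<comment> \<open>The jump count is measurable as a pointwise limit of dyadic counts, each
    depending on finitely many times.\<close>
  have meas: "(\<lambda>\<omega>. real (card (jump_times R' (\<lambda>u. X u \<omega>) s t))) \<in> borel_measurable M"
    if irr: "irreflp R'" for R'
    by (intro borel_measurable_LIMSEQ_real[OF conv[OF irr]] borel_measurable_integrable dyadic_count_integrable(1))
  let ?D = "\<lambda>\<omega>. real (card (jump_times (\<noteq>) (\<lambda>u. X u \<omega>) s t))"
  have neq: "irreflp ((\<noteq>) :: 's \<Rightarrow> 's \<Rightarrow> bool)" by (simp add: irreflp_def)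
  have mono: "incseq (\<lambda>m. real (dyadic_count (\<noteq>) f s t m))" for f :: "real \<Rightarrow> 's"
    by (intro incseq_SucI of_nat_mono dyadic_count_neq_mono)
  have D: "integrable M ?D"
  proof (rule integrable_monotone_convergence)
    show "AE \<omega> in M. mono (\<lambda>m. real (dyadic_count (\<noteq>) (\<lambda>u. X u \<omega>) s t m))"
      using mono by simp
    show "AE \<omega> in M. (\<lambda>m. real (dyadic_count (\<noteq>) (\<lambda>u. X u \<omega>) s t m)) \<longlonglongrightarrow> ?D \<omega>"
      using conv[OF neq] by simp
  qed (rule dyadic_count_integrable(1) expectation_dyadic_count_limit[OF neq] meas[OF neq])+
  have "(\<lambda>m. expectation (\<lambda>\<omega>. real (dyadic_count R (\<lambda>u. X u \<omega>) s t m)))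
      \<longlonglongrightarrow> expectation (\<lambda>\<omega>. real (card (jump_times R (\<lambda>u. X u \<omega>) s t)))"
  proof (rule integral_dominated_convergence[where w = ?D])
    fix m
    have "real (dyadic_count R (\<lambda>u. X u \<omega>) s t m) \<le> ?D \<omega>" if "\<omega> \<in> space M" for \<omega>
    proof -
      have "real (dyadic_count R (\<lambda>u. X u \<omega>) s t m) \<le> real (dyadic_count (\<noteq>) (\<lambda>u. X u \<omega>) s t m)"
        using dyadic_count_le_neq[OF irrefl] by (rule of_nat_mono)
      also have "\<dots> \<le> ?D \<omega>"
        by (rule incseq_le[OF mono conv[OF neq that]])
      finally show ?thesis .
    qed
    then show "AE \<omega> in M. norm (real (dyadic_count R (\<lambda>u. X u \<omega>) s t m)) \<le> ?D \<omega>" by simp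
  qed (use D meas[OF irrefl] borel_measurable_integrable[OF dyadic_count_integrable(1)] conv[OF irrefl] in simp_all)
  with expectation_dyadic_count_limit[OF irrefl] show ?thesis
    by (blast intro: LIMSEQ_unique)
qed

end

end

section \<open>The exclusion process\<close>

locale sep =
  fixes N K :: nat and \<alpha> \<beta> \<delta> :: "nat \<Rightarrow> real"
  assumes N: "2 \<le> N"
    and \<alpha>: "\<And>l. l \<in> {1..K} \<Longrightarrow> 0 < \<alpha> l"
    and \<beta>: "\<And>l. l \<in> {1..K} \<Longrightarrow> 0 < \<beta> l"
    and \<delta>: "\<And>l. l \<in> {1..K} \<Longrightarrow> 0 < \<delta> l"
begin

abbreviation "S \<equiv> sep_states N K"
abbreviation "rate \<equiv> sep_rate N K \<alpha> \<beta> \<delta>"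

section \<open>The product measure\<close>

definition p :: "nat \<Rightarrow> real" where
  "p a = (if a = 0 then 1 else \<alpha> a / \<beta> a) / (1 + (\<Sum>l\<in>{1..K}. \<alpha> l / \<beta> l))"

definition weight :: "(nat \<Rightarrow> nat) \<Rightarrow> real" where
  "weight x = (\<Prod>i\<in>{1..N}. p (x i))"

lemma finite_S: "finite S"
  unfolding sep_states_def by (intro finite_PiE) auto

lemma norm_pos: "0 < 1 + (\<Sum>l\<in>{1..K}. \<alpha> l / \<beta> l)"
  using \<alpha> \<beta> by (intro add_pos_nonneg sum_nonneg) (auto intro: less_imp_le)

lemma p_pos: "a \<in> {0..K} \<Longrightarrow> 0 < p a"
  unfolding p_def using norm_pos \<alpha>[of a] \<beta>[of a] by auto

lemma sum_p: "(\<Sum>a\<in>{0..K}. p a) = 1"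
proof -
  have "(\<Sum>a\<in>{0..K}. p a) = p 0 + (\<Sum>a\<in>{1..K}. p a)"
    by (simp add: sum.atLeast_Suc_atMost)
  also have "\<dots> = (1 + (\<Sum>l\<in>{1..K}. \<alpha> l / \<beta> l)) / (1 + (\<Sum>l\<in>{1..K}. \<alpha> l / \<beta> l))"
    unfolding p_def add_divide_distrib sum_divide_distrib by (intro arg_cong2[of _ _ _ _ "(+)"] sum.cong) auto
  also have "\<dots> = 1" using norm_pos by simp
  finally show ?thesis .
qed

lemma weight_pos: "x \<in> S \<Longrightarrow> 0 < weight x"
  unfolding weight_def sep_states_def by (intro prod_pos p_pos) auto

text \<open>Cross-multiplying avoids dividing by \<open>p (x i)\<close>, so no positivity and no
  membership of \<open>x\<close> in \<open>S\<close> is required.\<close>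

lemma weight_upd:
  assumes "i \<in> {1..N}"
  shows "weight (x(i := a)) * p (x i) = weight x * p a"
proof -
  have "weight (x(i := a)) = p a * (\<Prod>j\<in>{1..N} - {i}. p (x j))"
    unfolding weight_def using assms by (subst prod.remove[of _ i]) (auto intro!: prod.cong)
  moreover have "weight x = p (x i) * (\<Prod>j\<in>{1..N} - {i}. p (x j))"
    unfolding weight_def using assms by (subst prod.remove[of _ i]) auto
  ultimately show ?thesis by simp
qed

lemma sum_weight: "(\<Sum>x\<in>S. weight x) = 1"
proof -
  have "(\<Sum>x\<in>S. weight x) = (\<Prod>i\<in>{1..N}. \<Sum>a\<in>{0..K}. p a)"
    unfolding weight_def sep_states_def by (intro prod_sum_PiE[symmetric]) auto
  then show ?thesis by (simp add: sum_p)
qed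

text \<open>The constraint is absorbed into the factor of site \<open>i\<close>, so the sum still
  factorises; every other site contributes 1.\<close>

lemma sum_weight_vacant:
  assumes i: "i \<in> {1..N}"
  shows "(\<Sum>x\<in>{x\<in>S. x i = 0}. weight x) = p 0"
proof -
  let ?f = "\<lambda>j a. if j = i \<and> a \<noteq> 0 then 0 else p a"
  have "(\<Sum>x\<in>{x\<in>S. x i = 0}. weight x) = (\<Sum>x\<in>S. \<Prod>j\<in>{1..N}. ?f j (x j))"
    using finite_S i
    by (intro sum.mono_neutral_cong_left) (auto simp: weight_def prod_zero_iff intro!: prod.cong)
  also have "\<dots> = (\<Prod>j\<in>{1..N}. \<Sum>a\<in>{0..K}. ?f j a)"
    unfolding sep_states_def by (intro prod_sum_PiE[symmetric]) auto
  also have "\<dots> = (\<Prod>j\<in>{1..N}. if j = i then p 0 else 1)"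
  proof (rule prod.cong[OF refl])
    fix j
    have "(\<Sum>a\<in>{0..K}. ?f i a) = (\<Sum>a\<in>{0}. p a)"
      by (intro sum.mono_neutral_cong_right) auto
    then show "(\<Sum>a\<in>{0..K}. ?f j a) = (if j = i then p 0 else 1)"
      by (cases "j = i") (auto simp: sum_p)
  qed
  also have "\<dots> = p 0" using i by simp
  finally show ?thesis .
qed

text \<open>This is the one-site balance \<open>p l * \<beta> l = p 0 * \<alpha> l\<close>; the
  other sites contribute the same factors on both sides.\<close>

lemma weight_arrival:
  assumes l: "l \<in> {1..K}" and i: "i \<in> {1..N}" and "x i = 0"
  shows "weight x * \<alpha> l = weight (x(i := l)) * \<beta> l"
proof -
  have "p l * \<beta> l = p 0 * \<alpha> l"
    using l \<beta>[OF l] unfolding p_def by auto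
  then have "p 0 * (weight x * \<alpha> l) = p 0 * (weight (x(i := l)) * \<beta> l)"
    using weight_upd[OF i, of x l] assms(3) by (metis mult.assoc mult.commute)
  then show ?thesis using p_pos[of 0] by simp
qed

text \<open>A hop merely exchanges the contents of two sites, and all sites have the same
  marginal.\<close>

lemma weight_hop:
  assumes "i \<in> {1..N}" "j \<in> {1..N}" "i \<noteq> j" "x i = l" "x j = 0" "l \<in> {1..K}"
  shows "weight (x(i := 0, j := l)) = weight x"
proof -
  have "weight (x(i := 0, j := l)) * p 0 = weight (x(i := 0)) * p l"
    using weight_upd[OF assms(2), of "x(i := 0)" l] assms by simp
  also have "\<dots> = weight x * p 0"
    using weight_upd[OF assms(1), of x 0] assms by simp
  finally show ?thesis using p_pos[of 0] by simp
qed

section \<open>Detailed balance\<close>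

text \<open>The rate is split by kind of transition because balance pairs arrivals with departures,
  and hops with hops, of the same type.\<close>

definition arrivals :: "nat \<Rightarrow> (nat \<Rightarrow> nat) \<Rightarrow> (nat \<Rightarrow> nat) \<Rightarrow> real" where
  "arrivals l x y = (\<Sum>i\<in>{1, N}. if x i = 0 \<and> y = x(i := l) then \<alpha> l else 0)"

definition departures :: "nat \<Rightarrow> (nat \<Rightarrow> nat) \<Rightarrow> (nat \<Rightarrow> nat) \<Rightarrow> real" where
  "departures l x y = (\<Sum>i\<in>{1, N}. if x i = l \<and> y = x(i := 0) then \<beta> l else 0)"

definition hops :: "nat \<Rightarrow> (nat \<Rightarrow> nat) \<Rightarrow> (nat \<Rightarrow> nat) \<Rightarrow> real" where
  "hops l x y = (\<Sum>i\<in>{1..N}. \<Sum>j\<in>{1..N}.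
     if \<bar>int i - int j\<bar> = 1 \<and> x i = l \<and> x j = 0 \<and> y = x(i := 0, j := l) then \<delta> l else 0)"

lemma rate_eq: "rate x y = (\<Sum>l\<in>{1..K}. arrivals l x y + departures l x y + hops l x y)"
  unfolding sep_rate_def arrivals_def departures_def hops_def ..

text \<open>Site by site, an arrival from \<open>x\<close> to \<open>y\<close> is undone precisely
  by a departure from \<open>y\<close> to \<open>x\<close>.\<close>

lemma arrivals_reversible:
  assumes l: "l \<in> {1..K}"
  shows "weight x * arrivals l x y = weight y * departures l y x"
  unfolding arrivals_def departures_def sum_distrib_left
proof (rule sum.cong[OF refl])
  fix i assume "i \<in> {1, N}"
  then have i: "i \<in> {1..N}" using N by auto
  define P where "P \<longleftrightarrow> x i = 0 \<and> y = x(i := l)"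
  have iff: "y i = l \<and> x = y(i := 0) \<longleftrightarrow> P" unfolding P_def by (auto simp: fun_eq_iff)
  have "weight x * \<alpha> l = weight y * \<beta> l" if P
    using that weight_arrival[OF l i, of x] unfolding P_def by blast
  then show "weight x * (if x i = 0 \<and> y = x(i := l) then \<alpha> l else 0) =
      weight y * (if y i = l \<and> x = y(i := 0) then \<beta> l else 0)"
    unfolding iff P_def[symmetric] by (cases P) simp_all
qed

lemma hop_reverse:
  fixes x y :: "nat \<Rightarrow> nat"
  assumes "i \<noteq> j" "x j = l" "x i = 0" "y = x(j := 0, i := l)"
  shows "y i = l \<and> y j = 0 \<and> x = y(i := 0, j := l)"
  using assms(1-3) unfolding assms(4) by auto

lemma hops_reversible:
  assumes l: "l \<in> {1..K}"
  shows "weight x * hops l x y = weight y * hops l y x"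
  unfolding hops_def sum_distrib_left
\<comment> \<open>Swapping the sums on the left aligns the hop from \<open>j\<close> to
  \<open>i\<close> with its reversal from \<open>i\<close> to \<open>j\<close>, which has the same
  rate.\<close>
proof (subst sum.swap, rule sum.cong[OF refl], rule sum.cong[OF refl])
  fix i j assume ij: "i \<in> {1..N}" "j \<in> {1..N}"
  define P where "P \<longleftrightarrow> \<bar>int j - int i\<bar> = 1 \<and> x j = l \<and> x i = 0 \<and> y = x(j := 0, i := l)"
  have iff: "\<bar>int i - int j\<bar> = 1 \<and> y i = l \<and> y j = 0 \<and> x = y(i := 0, j := l) \<longleftrightarrow> P"
  proof -
    have ne: "i \<noteq> j" if "\<bar>int i - int j\<bar> = 1" using that by auto
    show ?thesis
      unfolding P_def abs_minus_commute[of "int j"]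
      using ne hop_reverse[of i j x l y] hop_reverse[of j i y l x] by blast
  qed
  have "weight x = weight y" if P
  proof -
    have "j \<noteq> i" and y: "x j = l" "x i = 0" "y = x(j := 0, i := l)" using that unfolding P_def by auto
    then show ?thesis unfolding y(3) using weight_hop[OF ij(2,1)] l by metis
  qed
  then show "weight x * (if \<bar>int j - int i\<bar> = 1 \<and> x j = l \<and> x i = 0 \<and> y = x(j := 0, i := l) then \<delta> l else 0) =
      weight y * (if \<bar>int i - int j\<bar> = 1 \<and> y i = l \<and> y j = 0 \<and> x = y(i := 0, j := l) then \<delta> l else 0)"
    unfolding iff P_def[symmetric] by (cases P) simp_all
qed

lemma rate_reversible: "weight x * rate x y = weight y * rate y x"
  unfolding rate_eq sum_distrib_left
proof (rule sum.cong[OF refl])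
  fix l assume "l \<in> {1..K}"
  then show "weight x * (arrivals l x y + departures l x y + hops l x y) =
      weight y * (arrivals l y x + departures l y x + hops l y x)"
    using arrivals_reversible[of l x y] arrivals_reversible[of l y x] hops_reversible[of l x y]
    unfolding distrib_left by linarith
qed

section \<open>Positive rates and accessibility of the empty configuration\<close>

lemma arrivals_nonneg: "l \<in> {1..K} \<Longrightarrow> 0 \<le> arrivals l x y"
  using \<alpha>[of l] unfolding arrivals_def by (intro sum_nonneg) (simp split: if_split)

lemma departures_nonneg: "l \<in> {1..K} \<Longrightarrow> 0 \<le> departures l x y"
  using \<beta>[of l] unfolding departures_def by (intro sum_nonneg) (simp split: if_split)

lemma hops_nonneg: "l \<in> {1..K} \<Longrightarrow> 0 \<le> hops l x y"
  using \<delta>[of l] unfolding hops_def by (intro sum_nonneg) (simp split: if_split)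

lemma rate_nonneg: "0 \<le> rate x y"
  unfolding rate_eq
  by (intro sum_nonneg add_nonneg_nonneg arrivals_nonneg departures_nonneg hops_nonneg)

text \<open>One nonnegative summand bounds the total rate from below, so a single possible move
  already makes the rate positive.\<close>

lemma rate_ge:
  assumes l: "l \<in> {1..K}"
  shows "departures l x y \<le> rate x y" "hops l x y \<le> rate x y"
proof -
  have "arrivals l x y + departures l x y + hops l x y \<le> rate x y"
    unfolding rate_eq using l
    by (intro member_le_sum[of l _ "\<lambda>l. arrivals l x y + departures l x y + hops l x y"]
        add_nonneg_nonneg arrivals_nonneg departures_nonneg hops_nonneg) auto
  then show "departures l x y \<le> rate x y" "hops l x y \<le> rate x y"
    using arrivals_nonneg[OF l, of x y] departures_nonneg[OF l, of x y] hops_nonneg[OF l, of x y]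
    by linarith+
qed

lemma rate_departure_pos:
  assumes x1: "x 1 \<in> {1..K}"
  shows "0 < rate x (x(1 := 0))"
proof -
  have "0 < departures (x 1) x (x(1 := 0))"
    unfolding departures_def using \<beta>[OF x1] by (intro sum_pos2[where i = 1]) auto
  then show ?thesis using rate_ge(1)[OF x1] by (rule less_le_trans)
qed

lemma rate_hop_left_pos:
  assumes "Suc i \<in> {1..N}" "i \<in> {1..N}" and l: "x (Suc i) \<in> {1..K}" and "x i = 0"
  shows "0 < rate x (x(Suc i := 0, i := x (Suc i)))"
proof -
  let ?l = "x (Suc i)" and ?y = "x(Suc i := 0, i := x (Suc i))"
  define h where "h m j = (if \<bar>int m - int j\<bar> = 1 \<and> x m = ?l \<and> x j = 0 \<and> ?y = x(m := 0, j := ?l)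
    then \<delta> ?l else 0)" for m j
  have h: "0 \<le> h m j" for m j
    using \<delta>[OF l] unfolding h_def by simp
  have "0 < h (Suc i) i"
    using \<delta>[OF l] assms unfolding h_def by simp
  then have "0 < (\<Sum>j\<in>{1..N}. h (Suc i) j)"
    using assms(2) h by (intro sum_pos2[where i = i]) auto
  then have "0 < (\<Sum>m\<in>{1..N}. \<Sum>j\<in>{1..N}. h m j)"
    using assms(1) h by - (rule sum_pos2[where i = "Suc i"], auto intro!: sum_nonneg)
  then have "0 < hops ?l x ?y"
    unfolding hops_def h_def .
  then show ?thesis using rate_ge(2)[OF l] by (rule less_le_trans)
qed

text \<open>The leftmost particle can always leave at site 1 or hop to the left, which decreases the
  sum of the positions of all particles; hence the empty configuration is accessible.\<close>

lemma constant_along_rates: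
  assumes step: "\<And>x y. x \<in> S \<Longrightarrow> y \<in> S \<Longrightarrow> 0 < rate x y \<Longrightarrow> f x = f y"
    and x: "x \<in> S"
  shows "f x = f (\<lambda>i\<in>{1..N}. 0)"
  using x
proof (induction "\<Sum>i\<in>{1..N}. if x i = 0 then 0 else i" arbitrary: x rule: less_induct)
  case less
  show ?case
  proof (cases "\<exists>i\<in>{1..N}. x i \<noteq> 0")
    case False
    then have "x = (\<lambda>i\<in>{1..N}. 0)"
      using less.prems unfolding sep_states_def by (auto simp: PiE_def extensional_def fun_eq_iff)
    then show ?thesis by simp
  next
    case True
    define i where "i = (LEAST i. i \<in> {1..N} \<and> x i \<noteq> 0)"
    have i: "i \<in> {1..N}" "x i \<noteq> 0"
      using LeastI_ex[of "\<lambda>i. i \<in> {1..N} \<and> x i \<noteq> 0"] True unfolding i_def by blast+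
    have min: "x j = 0" if "j \<in> {1..N}" "j < i" for j
      using not_less_Least[of j "\<lambda>i. i \<in> {1..N} \<and> x i \<noteq> 0"] that unfolding i_def by blast
    have xi: "x i \<in> {1..K}"
      using less.prems i unfolding sep_states_def by (force simp: PiE_iff)
    have "\<exists>y\<in>S. 0 < rate x y \<and>
        (\<Sum>i\<in>{1..N}. if y i = 0 then 0 else i) < (\<Sum>i\<in>{1..N}. if x i = 0 then 0 else i)"
    proof (cases "i = 1")
      case True
      have "x(1 := 0) \<in> S"
        using less.prems i True unfolding sep_states_def by (auto simp: PiE_iff extensional_def)
      moreover have "(\<Sum>i\<in>{1..N}. if (x(1 := 0)) i = 0 then 0 else i) < (\<Sum>i\<in>{1..N}. if x i = 0 then 0 else i)"
        using i True by (intro sum_strict_mono_strong[where a = 1]) auto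
      ultimately show ?thesis
        using rate_departure_pos[of x] xi True by auto
    next
      case False
      then obtain j where j: "i = Suc j" "j \<in> {1..N}"
        using i by (cases i) auto
      let ?y = "x(Suc j := 0, j := x (Suc j))"
      have xj: "x j = 0" using min[of j] j by simp
      have "?y \<in> S"
        using less.prems i j unfolding sep_states_def by (auto simp: PiE_iff extensional_def)
      moreover have "(\<Sum>i\<in>{1..N}. if ?y i = 0 then 0 else i) < (\<Sum>i\<in>{1..N}. if x i = 0 then 0 else i)"
      proof -
        \<comment> \<open>Isolating the two affected sites shows the change: the contribution
          \<open>Suc j\<close> is replaced by \<open>j\<close>.\<close>
        have sub: "{1..N} = insert j (insert (Suc j) ({1..N} - {j, Suc j}))" using i j by auto
        have split: "(\<Sum>i\<in>{1..N}. g i) = g j + (g (Suc j) + (\<Sum>i\<in>{1..N} - {j, Suc j}. g i))" for g :: "nat \<Rightarrow> nat"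
          by (subst sub) (subst sum.insert; simp)+
        have "(\<Sum>i\<in>{1..N} - {j, Suc j}. if ?y i = 0 then 0 else i) =
            (\<Sum>i\<in>{1..N} - {j, Suc j}. if x i = 0 then 0 else i)"
          by (intro sum.cong) auto
        then show ?thesis unfolding split using i j xj by simp
      qed
      ultimately show ?thesis
        using rate_hop_left_pos[of j x] i xi j xj by auto
    qed
    then obtain y where "y \<in> S" "0 < rate x y"
      "(\<Sum>i\<in>{1..N}. if y i = 0 then 0 else i) < (\<Sum>i\<in>{1..N}. if x i = 0 then 0 else i)"
      by blast
    then show ?thesis using less.hyps[of y] step[of x y] less.prems by simp
  qed
qed

text \<open>The ratio to \<open>weight\<close> is constant along transitions of positive rate, hence
  on all of \<open>S\<close>; since both functions have total mass 1, the constant is 1.\<close>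

lemma stationary_eq_weight:
  assumes stat: "stationary_distribution S rate \<pi>" and x: "x \<in> S"
  shows "\<pi> x = weight x"
proof -
  let ?c = "\<pi> (\<lambda>i\<in>{1..N}. 0) / weight (\<lambda>i\<in>{1..N}. 0)"
  have "\<pi> x / weight x = ?c" if "x \<in> S" for x
  proof (rule constant_along_rates[where f = "\<lambda>x. \<pi> x / weight x", OF _ that])
    fix x y assume "x \<in> S" "y \<in> S" "0 < rate x y"
    then show "\<pi> x / weight x = \<pi> y / weight y"
      by (intro reversible_stationary_ratio[OF finite_S weight_pos rate_nonneg rate_reversible
          stationary_distribution_generator[OF finite_S stat]])
  qed
  then have eq: "\<pi> x = ?c * weight x" if "x \<in> S" for x
    using that weight_pos[OF that] by (metis less_irrefl nonzero_eq_divide_eq)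
  have "1 = (\<Sum>x\<in>S. \<pi> x)" using stat unfolding stationary_distribution_def by simp
  also have "\<dots> = (\<Sum>x\<in>S. ?c * weight x)" by (intro sum.cong eq refl)
  also have "\<dots> = ?c" by (simp only: sum_distrib_left[symmetric] sum_weight mult_1_right)
  finally show ?thesis using eq[OF x] by simp
qed

section \<open>Arrival rates under the product measure\<close>

text \<open>No other transition has the same target: a departure cannot fill the vacant site
  \<open>i\<close>, a hop would empty another site, and an arrival determines its site and
  type.\<close>

lemma rate_arrival:
  assumes k: "k \<in> {1..K}" and i: "i \<in> {1, N}" and xi: "x i = 0"
  shows "rate x (x(i := k)) = \<alpha> k"
proof -
  have arr: "arrivals l x (x(i := k)) = (if l = k then \<alpha> k else 0)" if l: "l \<in> {1..K}" for l
  proof -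
    have "x j = 0 \<and> x(i := k) = x(j := l) \<longleftrightarrow> j = i \<and> l = k" for j
    proof
      assume "x j = 0 \<and> x(i := k) = x(j := l)"
      then have "(x(j := l)) i = k" by (metis fun_upd_same)
      then show "j = i \<and> l = k" using k xi by (auto split: if_splits)
    qed (use xi in auto)
    then have "arrivals l x (x(i := k)) = (\<Sum>j\<in>{1, N}. if j = i then (if l = k then \<alpha> k else 0) else 0)"
      unfolding arrivals_def by (intro sum.cong) auto
    then show ?thesis using i by (simp only: sum.delta finite.intros if_True)
  qed
  have dep: "departures l x (x(i := k)) = 0" for l
  proof -
    have "x(i := k) \<noteq> x(j := 0)" for j
    proof
      assume "x(i := k) = x(j := 0)"
      then have "(x(j := 0)) i = k" by (metis fun_upd_same)
      then show False using k xi by (auto split: if_splits)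
    qed
    then show ?thesis unfolding departures_def by simp
  qed
  have hop: "hops l x (x(i := k)) = 0" if l: "l \<in> {1..K}" for l
  proof -
    have "\<not> (\<bar>int m - int j\<bar> = 1 \<and> x m = l \<and> x j = 0 \<and> x(i := k) = x(m := 0, j := l))" for m j
    proof
      assume A: "\<bar>int m - int j\<bar> = 1 \<and> x m = l \<and> x j = 0 \<and> x(i := k) = x(m := 0, j := l)"
      \<comment> \<open>The source \<open>m\<close> is occupied, whereas \<open>i\<close> and
        \<open>j\<close> are vacant; the hop would empty \<open>m\<close>, which the arrival at
        \<open>i\<close> leaves untouched.\<close>
      then have "m \<noteq> j" "m \<noteq> i" using l xi by auto
      then have "x m = (x(m := 0, j := l)) m" using A by (metis fun_upd_other)
      then show False using \<open>m \<noteq> j\<close> A l by simp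
    qed
    then show ?thesis unfolding hops_def by (simp only: if_False sum.neutral_const)
  qed
  have "rate x (x(i := k)) = (\<Sum>l\<in>{1..K}. if l = k then \<alpha> k else 0)"
    unfolding rate_eq by (intro sum.cong refl) (simp only: arr dep hop add_0_right)
  then show ?thesis using k by (simp only: sum.delta finite_atLeastAtMost if_True)
qed

text \<open>Written as a relation between the states before and after a jump, so that the general
  jump count applies.\<close>

definition arrival :: "nat \<Rightarrow> (nat \<Rightarrow> nat) \<Rightarrow> (nat \<Rightarrow> nat) \<Rightarrow> bool" where
  "arrival k x y \<longleftrightarrow> (\<exists>i\<in>{1, N}. x i = 0 \<and> y = x(i := k))"

lemma arrival_times_eq: "arrival_times N k f s t = jump_times (arrival k) f s t"
  unfolding arrival_times_def jump_times_def arrival_def ..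

text \<open>Since \<open>k\<close> is nonzero, filling different vacant sites gives different
  targets, so the sum over targets becomes one over vacant boundary sites.\<close>

lemma total_arrival_rate:
  assumes k: "k \<in> {1..K}" and x: "x \<in> S"
  shows "(\<Sum>y\<in>{y\<in>S. arrival k x y}. rate x y) = (\<Sum>i\<in>{1, N}. if x i = 0 then \<alpha> k else 0)"
proof -
  have S: "x(i := k) \<in> S" if "i \<in> {1, N}" for i
    using x k that N unfolding sep_states_def by (auto simp: PiE_iff extensional_def)
  have inj: "inj_on (\<lambda>i. x(i := k)) {i\<in>{1, N}. x i = 0}"
  proof (rule inj_onI)
    fix i j assume A: "i \<in> {i\<in>{1, N}. x i = 0}" "x(i := k) = x(j := k)"
    then have "(x(i := k)) i = (x(j := k)) i" by metis
    then show "i = j" using A(1) k by (auto split: if_splits)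
  qed
  have "{y\<in>S. arrival k x y} = (\<lambda>i. x(i := k)) ` {i\<in>{1, N}. x i = 0}"
    using S unfolding arrival_def by blast
  then have "(\<Sum>y\<in>{y\<in>S. arrival k x y}. rate x y) = (\<Sum>i\<in>{i\<in>{1, N}. x i = 0}. rate x (x(i := k)))"
    using inj by (simp add: sum.reindex)
  also have "\<dots> = (\<Sum>i\<in>{i\<in>{1, N}. x i = 0}. \<alpha> k)"
    by (intro sum.cong refl rate_arrival k) auto
  also have "\<dots> = (\<Sum>i\<in>{1, N}. if x i = 0 then \<alpha> k else 0)"
    by (intro sum.inter_filter) auto
  finally show ?thesis .
qed

text \<open>After exchanging the sums, each boundary site contributes \<alpha> at \<open>k\<close>
  times its vacancy probability \<open>p 0\<close>.\<close>

lemma mean_arrival_rate: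
  assumes k: "k \<in> {1..K}"
  shows "(\<Sum>x\<in>S. \<Sum>y\<in>{y\<in>S. arrival k x y}. weight x * rate x y) = 2 * \<alpha> k * p 0"
proof -
  have "(\<Sum>x\<in>S. \<Sum>y\<in>{y\<in>S. arrival k x y}. weight x * rate x y) =
      (\<Sum>x\<in>S. \<Sum>i\<in>{1, N}. if x i = 0 then weight x * \<alpha> k else 0)"
  proof (rule sum.cong[OF refl])
    fix x assume "x \<in> S"
    then have "(\<Sum>y\<in>{y\<in>S. arrival k x y}. weight x * rate x y) =
        weight x * (\<Sum>i\<in>{1, N}. if x i = 0 then \<alpha> k else 0)"
      by (simp only: total_arrival_rate[OF k] flip: sum_distrib_left)
    also have "\<dots> = (\<Sum>i\<in>{1, N}. if x i = 0 then weight x * \<alpha> k else 0)"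
      unfolding sum_distrib_left by (intro sum.cong) auto
    finally show "(\<Sum>y\<in>{y\<in>S. arrival k x y}. weight x * rate x y) =
        (\<Sum>i\<in>{1, N}. if x i = 0 then weight x * \<alpha> k else 0)" .
  qed
  also have "\<dots> = (\<Sum>i\<in>{1, N}. \<Sum>x\<in>S. if x i = 0 then weight x * \<alpha> k else 0)"
    by (rule sum.swap)
  also have "\<dots> = (\<Sum>i\<in>{1, N}. p 0 * \<alpha> k)"
  proof (rule sum.cong[OF refl])
    fix i assume "i \<in> {1, N}"
    then have i: "i \<in> {1..N}" using N by auto
    have "(\<Sum>x\<in>S. if x i = 0 then weight x * \<alpha> k else 0) = (\<Sum>x\<in>{x\<in>S. x i = 0}. weight x * \<alpha> k)"
      by (rule sum.inter_filter[OF finite_S, symmetric])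
    also have "\<dots> = p 0 * \<alpha> k"
      by (simp only: sum_weight_vacant[OF i] flip: sum_distrib_right)
    finally show "(\<Sum>x\<in>S. if x i = 0 then weight x * \<alpha> k else 0) = p 0 * \<alpha> k" .
  qed
  \<comment> \<open>The factor 2 arises because \<open>N \<ge> 2\<close> makes sites 1 and
    \<open>N\<close> distinct.\<close>
  also have "\<dots> = 2 * \<alpha> k * p 0" using N by simp
  finally show ?thesis .
qed

end

theorem theorem5:
  fixes N K k :: nat and \<alpha> \<beta> \<delta> :: "nat \<Rightarrow> real"
    and M :: "'w measure" and X :: "real \<Rightarrow> 'w \<Rightarrow> nat \<Rightarrow> nat" and s t :: real
  assumes "N \<ge> 2" and "K \<ge> 1"
    and "\<And>l. l \<in> {1..K} \<Longrightarrow> \<alpha> l > 0"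
    and "\<And>l. l \<in> {1..K} \<Longrightarrow> \<beta> l > 0"
    and "\<And>l. l \<in> {1..K} \<Longrightarrow> \<delta> l > 0"
    and "markov_chain (sep_states N K) (sep_rate N K \<alpha> \<beta> \<delta>) M X"
    and "stationary_distribution (sep_states N K) (sep_rate N K \<alpha> \<beta> \<delta>)
           (\<lambda>x. measure M {\<omega> \<in> space M. X 0 \<omega> = x})"
    and "k \<in> {1..K}"
    and "0 \<le> s" and "s < t"
  shows "arrival_rate N k M X s t = 2 * \<alpha> k / (1 + (\<Sum>l\<in>{1..K}. \<alpha> l / \<beta> l))"
proof -
  interpret sep N K \<alpha> \<beta> \<delta>
    using assms by unfold_locales auto
  let ?\<pi> = "\<lambda>x. measure M {\<omega> \<in> space M. X 0 \<omega> = x}"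
  interpret stationary_chain S rate M X ?\<pi>
    using assms finite_S by unfold_locales auto
  \<comment> \<open>An arrival puts the nonzero type \<open>k\<close> on a vacant site, so it always
    changes the state.\<close>
  have irrefl: "irreflp (arrival k)"
  proof (rule irreflpI, rule notI)
    fix x assume "arrival k x x"
    then obtain i where "x i = 0" "x = x(i := k)" unfolding arrival_def by blast
    then have "k = 0" by (metis fun_upd_same)
    then show False using assms(8) by simp
  qed
  have "expectation (\<lambda>\<omega>. real (card (arrival_times N k (\<lambda>u. X u \<omega>) s t))) =
      (t - s) * (\<Sum>x\<in>S. \<Sum>y\<in>{y\<in>S. arrival k x y}. ?\<pi> x * rate x y)"
    unfolding arrival_times_eq using assms(9,10) irrefl by (rule expectation_jump_times)
  also have "(\<Sum>x\<in>S. \<Sum>y\<in>{y\<in>S. arrival k x y}. ?\<pi> x * rate x y) =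
      (\<Sum>x\<in>S. \<Sum>y\<in>{y\<in>S. arrival k x y}. weight x * rate x y)"
    using stationary_eq_weight[OF assms(7)] by (intro sum.cong) auto
  also have "\<dots> = 2 * \<alpha> k / (1 + (\<Sum>l\<in>{1..K}. \<alpha> l / \<beta> l))"
    using mean_arrival_rate[OF assms(8)] by (simp add: p_def)
  finally show ?thesis
    using assms(10) unfolding arrival_rate_def by simp
qed

end
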